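(* Let $G$ be a finite group and $\mathcal{S}$ a 2-dimensional simplicial complex whose vertices are elements of $G$, such that $\mathcal{C}=Sc[\mathcal{S},G]$ is a commutative triplet structure. Then \[\lambda(G_{walk}(\mathcal{C}))\le\sqrt{\tfrac12+\tfrac12\,\lambda\big(G_{dual}\,ⓩ\, L\big)}.\]
   Context: For a 2-complex $X$: $X(1)$ is the set of 2-sets contained in a triangle, $X(2)$ the set of triangles; $X$ is $\tilde d$-regular if every edge of $X(1)$ is in exactly $\tilde d$ triangles. $G_{walk}(X)$ is the graph on $X(1)$ where two distinct edges are adjacent iff they lie in a common triangle. $\lambda(\cdot)$ is the maximal non-trivial eigenvalue of the normalized adjacency operator. For $\sigma\subseteq G$, $g\in G$, put $\sigma\cdot g=\{sg:s\in\sigma\}$. $Sc[\mathcal{S},G]=\{\sigma\cdot g:\sigma\in\mathcal{S},g\in G\}$ (a complex on $G$). Let $\mathcal{T}=\mathcal{S}(1)$ and $\mathcal{T}_o$ the set of ordered pairs $(t_1,t_2)$ with $\{t_1,t_2\}\in\mathcal{T}$. $\mathcal{C}$ is a commutative triplet structure (CTS) if: (0) $\{s,s^{-1}\}\notin\mathcal{S}(1)$ for every vertex $s$ of $\mathcal{S}$; (A) $\mathcal{S}$ is $\tilde d$-regular for some $\tilde d$; (B) $ab=ba$ for all $\{a,b\}\in\mathcal{T}$; (C) $\{a,b\}\in\mathcal{T}\iff\{a^{-1},b^{-1}\}\in\mathcal{T}$; (D) for $t\neq t'\in\mathcal{T}_o$, $t_1t_2^{-1}=t'_1(t'_2)^{-1}$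 implies $t'_2=t_1^{-1}$ and $t'_1=t_2^{-1}$; (E) the 1-skeleton of $\mathcal{S}$ (vertices of $\mathcal{S}$, edges $\mathcal{T}$) is connected. For $\tau=\{a,b\}\in\mathcal{T}$ write $\hat\tau g=abg$ and $\tau^{-1}=\{a^{-1},b^{-1}\}$. $L=G_{walk}(\mathcal{S})$. $G_{dual}$ is the graph on $G$ with edges $\{g,\hat\tau g\}$ for $g\in G,\tau\in\mathcal{T}$. The replacement product on $G\times\mathcal{T}$ has red edges $(g,\tau)\sim(g,\tau')$ for $\tau\sim\tau'$ in $L$, and blue edges $(g,\tau)\sim(\hat\tau g,\tau^{-1})$; $P_R,P_B$ are the normalized adjacency matrices of red and blue edges. The zig-zag product $G_{dual}ⓩL$ is the graph on $G\times\mathcal{T}$ with normalized adjacency operator $P_RP_BP_R$. *)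

theory Defs
  imports "Jordan_Normal_Form.Char_Poly" "HOL-Algebra.Group" "HOL-Computational_Algebra.Polynomial"
begin

section \<open>2-complexes, given by their set of triangles\<close>

(* X(1): the 2-sets contained in a triangle *)
definition cx_edges :: "'a set set \<Rightarrow> 'a set set" where
  "cx_edges X2 = {e. card e = 2 \<and> (\<exists>t\<in>X2. e \<subseteq> t)}"

(* adjacency of G_walk(X): distinct edges lying in a common triangle *)
definition walk_rel :: "'a set set \<Rightarrow> 'a set \<Rightarrow> 'a set \<Rightarrow> bool" where
  "walk_rel X2 e e' \<longleftrightarrow> e \<noteq> e' \<and> (\<exists>t\<in>X2. e \<subseteq> t \<and> e' \<subseteq> t)"

section \<open>Normalized adjacency operators and the maximal non-trivial eigenvalue\<close>

(* a fixed enumeration of a finite vertex set (spectra do not depend on it) *)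
definition enum_set :: "'v set \<Rightarrow> 'v list" where
  "enum_set V = (SOME xs. distinct xs \<and> set xs = V)"

(* normalized adjacency (random walk) matrix D^{-1} A of the graph (V, R) *)
definition norm_adj :: "'v set \<Rightarrow> ('v \<Rightarrow> 'v \<Rightarrow> bool) \<Rightarrow> real mat" where
  "norm_adj V R = (let xs = enum_set V in
     mat (length xs) (length xs)
       (\<lambda>(i, j). if R (xs ! i) (xs ! j)
                 then 1 / real (card {y \<in> V. R (xs ! i) y}) else 0))"

(* eigenvalues with multiplicity, in decreasing order; lambda = the second one *)
definition eigs_desc :: "real mat \<Rightarrow> real list" where
  "eigs_desc M = rev (sorted_list_of_multiset (proots (char_poly M)))"

definition lambda_nt :: "real mat \<Rightarrow> real" where
  "lambda_nt M = eigs_desc M ! 1"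

section \<open>Group-translates and commutative triplet structures\<close>

definition rtrans :: "('g, 'b) monoid_scheme \<Rightarrow> 'g set \<Rightarrow> 'g \<Rightarrow> 'g set" where
  "rtrans G \<sigma> g = (\<lambda>s. s \<otimes>\<^bsub>G\<^esub> g) ` \<sigma>"

(* triangles of Sc[S,G] *)
definition Sc :: "'g set set \<Rightarrow> ('g, 'b) monoid_scheme \<Rightarrow> 'g set set" where
  "Sc S G = {rtrans G \<sigma> g | \<sigma> g. \<sigma> \<in> S \<and> g \<in> carrier G}"

definition is_2complex_on :: "('g, 'b) monoid_scheme \<Rightarrow> 'g set set \<Rightarrow> bool" where
  "is_2complex_on G S \<longleftrightarrow> S \<noteq> {} \<and> (\<forall>t\<in>S. card t = 3 \<and> t \<subseteq> carrier G)"

definition CTS :: "('g, 'b) monoid_scheme \<Rightarrow> 'g set set \<Rightarrow> bool" where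
  "CTS G S \<longleftrightarrow>
     (\<forall>s\<in>\<Union>S. {s, inv\<^bsub>G\<^esub> s} \<notin> cx_edges S) \<and>
     (\<exists>d::nat. \<forall>e\<in>cx_edges S. card {t\<in>S. e \<subseteq> t} = d) \<and>
     (\<forall>a b. {a, b} \<in> cx_edges S \<longrightarrow> a \<otimes>\<^bsub>G\<^esub> b = b \<otimes>\<^bsub>G\<^esub> a) \<and>
     (\<forall>a\<in>carrier G. \<forall>b\<in>carrier G.
        {a, b} \<in> cx_edges S \<longleftrightarrow> {inv\<^bsub>G\<^esub> a, inv\<^bsub>G\<^esub> b} \<in> cx_edges S) \<and>
     (\<forall>t1 t2 u1 u2. {t1, t2} \<in> cx_edges S \<and> {u1, u2} \<in> cx_edges S \<and> (t1, t2) \<noteq> (u1, u2) \<and>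
        t1 \<otimes>\<^bsub>G\<^esub> inv\<^bsub>G\<^esub> t2 = u1 \<otimes>\<^bsub>G\<^esub> inv\<^bsub>G\<^esub> u2 \<longrightarrow>
        u2 = inv\<^bsub>G\<^esub> t1 \<and> u1 = inv\<^bsub>G\<^esub> t2) \<and>
     (\<forall>u\<in>\<Union>S. \<forall>v\<in>\<Union>S. (u, v) \<in> {(a, b). {a, b} \<in> cx_edges S}\<^sup>*)"

section \<open>Zig-zag product G_dual (z) L\<close>

(* \<tau>-hat: for \<tau> = {a,b}, the product ab (well defined since ab = ba) *)
definition edge_prod :: "('g, 'b) monoid_scheme \<Rightarrow> 'g set \<Rightarrow> 'g" where
  "edge_prod G \<tau> = (SOME p. \<exists>a b. \<tau> = {a, b} \<and> a \<noteq> b \<and> p = a \<otimes>\<^bsub>G\<^esub> b)"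

definition red_rel :: "'g set set \<Rightarrow> ('g \<times> 'g set) \<Rightarrow> ('g \<times> 'g set) \<Rightarrow> bool" where
  "red_rel S x y \<longleftrightarrow> fst x = fst y \<and> walk_rel S (snd x) (snd y)"

definition blue_step :: "('g, 'b) monoid_scheme \<Rightarrow> ('g \<times> 'g set) \<Rightarrow> ('g \<times> 'g set)" where
  "blue_step G x = (edge_prod G (snd x) \<otimes>\<^bsub>G\<^esub> fst x, (\<lambda>a. inv\<^bsub>G\<^esub> a) ` snd x)"

definition blue_rel :: "('g, 'b) monoid_scheme \<Rightarrow> ('g \<times> 'g set) \<Rightarrow> ('g \<times> 'g set) \<Rightarrow> bool" where
  "blue_rel G x y \<longleftrightarrow> y = blue_step G x \<or> x = blue_step G y"

(* normalized adjacency operator P_R P_B P_R of G_dual (z) L on G \<times> T *)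
definition zigzag_op :: "('g, 'b) monoid_scheme \<Rightarrow> 'g set set \<Rightarrow> real mat" where
  "zigzag_op G S = (let V = carrier G \<times> cx_edges S in
     norm_adj V (red_rel S) * norm_adj V (blue_rel G) * norm_adj V (red_rel S))"

end

theory Submission
  imports Defs "Jordan_Normal_Form.Schur_Decomposition"
begin

text \<open>
  Condition (D), together with (0), says that the map sending (g, {a, b}) to {ag, bg} is exactly
  two-to-one onto the edges of the complex, its fibres being the blue edges. Lifting along it, the
  walk operator becomes the compression of the red operator P to the functions fixed by the blue
  involution B, that is (1 + B)/2 composed with P. If F is the lift of an eigenfunction for the
  second eigenvalue l, then F has mean zero and
  l^2 |F|^2 = (|PF|^2 + <PF, BPF>)/2 = (|PF|^2 + <F, PBPF>)/2.
  Since P is a contraction, and the second eigenvalue of PBP bounds its Rayleigh quotient on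
  functions of mean zero, the claim follows.
\<close>

section \<open>Second eigenvalue of a real symmetric matrix\<close>

text \<open>Two obstacles shape the proof. \<open>lambda_nt\<close> is an entry of a sorted list of
  roots, so the characteristic polynomial must split over the reals and the trivial eigenvalue must
  be located in the list. Eigenvalues count with multiplicity, and the second entry may again be 1;
  mean zero is therefore not deduced from distinctness of eigenvalues but read off an orthonormal
  eigenbasis whose first vector is constant. This is why the diagonalization carries a prescribed
  eigenvector. The other obstacle is that the walk on edges of \<open>Sc S G\<close> averages over a
  set of neighbours. The formula (1 + B)/2 composed with P needs the red neighbours of x and of its
  blue partner to project to pairwise distinct edges. Two-point fibres alone do not give this, since
  a blue edge might join the two red neighbourhoods. It cannot: edges adjacent in L share a vertex
  a, and ab = ac forces b = c.\<close>

lemma orthogonal_mat_with_first_col: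
  fixes v :: "real vec"
  assumes v: "v \<in> carrier_vec n" "v \<noteq> 0\<^sub>v n"
  obtains W c where "W \<in> carrier_mat n n" "transpose_mat W * W = 1\<^sub>m n"
    "c \<noteq> 0" "col W 0 = c \<cdot>\<^sub>v v"
proof -
  interpret cof_vec_space n "TYPE(real)" .
  define us where "us = gram_schmidt n (basis_completion v)"
  note bc = basis_completion[OF v]
  have us: "corthogonal us" "set us \<subseteq> carrier_vec n" "length us = n"
    using gram_schmidt_result[OF bc(2) bc(4) bc(5) us_def] bc(6) by auto
  have n: "0 < n" using v by (cases n) auto
  have "hd us = v"
    using gram_schmidt_hd[OF v(1)] bc(6,7) n unfolding us_def
    by (cases "basis_completion v") auto
  then have hd: "us ! 0 = v" using us(3) n by (metis hd_conv_nth length_0_conv less_numeral_extra(3))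
  have car: "us ! i \<in> carrier_vec n" if "i < n" for i using us that by auto
  have pos: "us ! i \<bullet> us ! i > 0" if "i < n" for i
    using corthogonalD[OF us(1), of i i] us(3) that
    by (simp add: scalar_prod_def) (metis (no_types, lifting) sum_nonneg less_eq_real_def zero_le_square)
  define s where "s = (\<lambda>i. 1 / sqrt (us ! i \<bullet> us ! i))"
  define W where "W = mat_of_cols n (map (\<lambda>i. s i \<cdot>\<^sub>v us ! i) [0..<n])"
  have W: "W \<in> carrier_mat n n" unfolding W_def carrier_mat_def by simp
  have col: "col W i = s i \<cdot>\<^sub>v us ! i" if "i < n" for i
    unfolding W_def using that car by (subst col_mat_of_cols) auto
  have "transpose_mat W * W = 1\<^sub>m n"
  proof (rule eq_matI)
    fix i j assume ij: "i < dim_row (1\<^sub>m n)" "j < dim_col (1\<^sub>m n :: real mat)"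
    hence "(transpose_mat W * W) $$ (i, j) = s i * s j * (us ! i \<bullet> us ! j)"
      using W col car[OF ij(1)[simplified]] car[OF ij(2)[simplified]] by simp
    also have "\<dots> = (if i = j then 1 else 0)"
      using corthogonalD[OF us(1), of i j] us(3) ij pos[of i]
      by (auto simp: s_def)
    finally show "(transpose_mat W * W) $$ (i, j) = 1\<^sub>m n $$ (i, j)" using ij by simp
  qed (use W in auto)
  moreover have "s 0 \<noteq> 0" using pos[OF n] by (simp add: s_def)
  ultimately show thesis using that W col[OF n] hd by metis
qed

text \<open>The fundamental theorem of algebra supplies a complex eigenpair l, z. By symmetry the
  Hermitian form of \<open>A\<close> at z is real, and it equals l times the positive number |z|^2,
  so l is real.\<close>

lemma symmetric_real_eigenvector:
  fixes A :: "real mat"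
  assumes A: "A \<in> carrier_mat n n" and sym: "transpose_mat A = A" and n: "n > 0"
  obtains v e where "v \<in> carrier_vec n" "v \<noteq> 0\<^sub>v n" "A *\<^sub>v v = e \<cdot>\<^sub>v v"
proof -
  let ?A = "map_mat complex_of_real A"
  have A': "?A \<in> carrier_mat n n" using A by simp
  have "\<not> constant (poly (char_poly ?A))"
    using degree_monic_char_poly[OF A'] n by (simp add: constant_degree)
  then obtain l where "poly (char_poly ?A) l = 0"
    using fundamental_theorem_of_algebra by blast
  then have "eigenvalue ?A l" using eigenvalue_root_char_poly[OF A'] by simp
  then obtain z where z: "z \<in> carrier_vec n" "z \<noteq> 0\<^sub>v n" "?A *\<^sub>v z = l \<cdot>\<^sub>v z"
    using A unfolding eigenvalue_def eigenvector_def by auto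
  have symA: "A $$ (i, j) = A $$ (j, i)" if "i < n" "j < n" for i j
    using sym A that by (metis carrier_matD index_transpose_mat(1))
  have ev: "(\<Sum>j<n. of_real (A $$ (i, j)) * z $ j) = l * z $ i" if "i < n" for i
    using arg_cong[OF z(3), of "\<lambda>v. v $ i"] A z(1) that
    by (simp add: scalar_prod_def atLeast0LessThan row_def)
  define N where "N = (\<Sum>i<n. (cmod (z $ i))\<^sup>2)"
  define s where "s = (\<Sum>i<n. \<Sum>j<n. cnj (z $ i) * (of_real (A $$ (i, j)) * z $ j))"
  have "s = (\<Sum>i<n. cnj (z $ i) * (l * z $ i))"
    unfolding s_def sum_distrib_left[symmetric] by (simp add: ev)
  also have "\<dots> = (\<Sum>i<n. l * of_real ((cmod (z $ i))\<^sup>2))"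
    by (intro sum.cong refl) (simp only: complex_norm_square mult_ac)
  finally have s: "s = l * of_real N"
    by (simp add: N_def sum_distrib_left)
  have "cnj s = s"
    unfolding s_def cnj_sum
    by (subst sum.swap) (auto simp: symA algebra_simps intro!: sum.cong)
  moreover have N: "N > 0"
  proof -
    obtain i where "i < n" "z $ i \<noteq> 0" using z by (metis eq_vecI carrier_vecD index_zero_vec)
    then show ?thesis unfolding N_def by (intro sum_pos2[of _ i]) auto
  qed
  ultimately have "cnj l = l" using s by simp
  then obtain e where e: "l = of_real e" by (metis Reals_cnj_iff Reals_cases)
  \<comment> \<open>\<open>z\<close> itself need not be real. A real eigenvector comes from
    \<open>e\<close> being a root of \<open>char_poly A\<close> over the reals.\<close>
  have "eigenvalue A e"
  proof -
    interpret of_real_hom: comm_ring_hom complex_of_real by (unfold_locales) auto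
    have "complex_of_real (poly (char_poly A) e) = 0"
      using \<open>poly (char_poly ?A) l = 0\<close> of_real_hom.char_poly_hom[OF A] e 
      by (metis of_real_hom.poly_map_poly)
    then show ?thesis using eigenvalue_root_char_poly[OF A] by simp
  qed
  then show thesis using that A unfolding eigenvalue_def eigenvector_def by auto
qed

lemma mult_mat_unit_vec:
  fixes A :: "'a::semiring_1 mat"
  shows "A \<in> carrier_mat m n \<Longrightarrow> j < n \<Longrightarrow> A *\<^sub>v unit_vec n j = col A j"
  by (intro eq_vecI) auto

text \<open>Deflation: an orthonormal basis starting with the known eigenvector splits off a 1 by 1
  block, and the complementary block is symmetric again. Prescribing the first column ties index 0
  to the trivial eigenvalue when \<open>v\<close> is the constant vector.\<close>

lemma symmetric_real_diagonalization:
  fixes A :: "real mat"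
  assumes "A \<in> carrier_mat n n" "transpose_mat A = A"
    and "v \<in> carrier_vec n" "v \<noteq> 0\<^sub>v n" "A *\<^sub>v v = e \<cdot>\<^sub>v v"
  shows "\<exists>Q c f. Q \<in> carrier_mat n n \<and> transpose_mat Q * Q = 1\<^sub>m n \<and> c \<noteq> 0
    \<and> col Q 0 = c \<cdot>\<^sub>v v \<and> f 0 = e
    \<and> transpose_mat Q * A * Q = mat n n (\<lambda>(i, j). if i = j then f i else 0)"
  using assms
proof (induction n arbitrary: A v e)
  case 0
  then show ?case by auto
next
  case (Suc m)
  note A = Suc.prems(1) and sym = Suc.prems(2) and v = Suc.prems(3)
  obtain W c where W: "W \<in> carrier_mat (Suc m) (Suc m)" "transpose_mat W * W = 1\<^sub>m (Suc m)"
    "c \<noteq> 0" "col W 0 = c \<cdot>\<^sub>v v"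
    using orthogonal_mat_with_first_col[OF v Suc.prems(4)] by metis
  define B where "B = transpose_mat W * A * W"
  have B: "B \<in> carrier_mat (Suc m) (Suc m)" using W A by (simp add: B_def)
  have symB: "transpose_mat B = B"
  proof -
    have "transpose_mat B = transpose_mat W * transpose_mat (transpose_mat W * A)"
      unfolding B_def using W A by (intro transpose_mult) auto
    also have "transpose_mat (transpose_mat W * A) = A * W"
      using W A sym transpose_mult[of "transpose_mat W" "Suc m" "Suc m" A "Suc m"] by simp
    finally show ?thesis unfolding B_def using W A
      by (metis assoc_mult_mat transpose_carrier_mat)
  qed
  have symB': "B $$ (i, j) = B $$ (j, i)" if "i < Suc m" "j < Suc m" for i j
    using symB B that by (metis carrier_matD index_transpose_mat(1))
  \<comment> \<open>Orthonormality turns the eigenvector in column 0 of \<open>W\<close> into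
    \<open>unit_vec (Suc m) 0\<close>; symmetry of \<open>B\<close> then clears the rest of row 0 as
    well.\<close>
  have "col B 0 = transpose_mat W *\<^sub>v (A *\<^sub>v col W 0)"
  proof -
    have "B = transpose_mat W * (A * W)"
      unfolding B_def using W(1) A by (intro assoc_mult_mat) auto
    then show ?thesis
      using W(1) A col_mult2[of "transpose_mat W" "Suc m" "Suc m" "A * W" "Suc m" 0]
        col_mult2[of A "Suc m" "Suc m" W "Suc m" 0] by simp
  qed
  also have "A *\<^sub>v col W 0 = e \<cdot>\<^sub>v col W 0"
    using W(4) Suc.prems A v by (simp add: mult_mat_vec smult_smult_assoc mult.commute)
  also have "transpose_mat W *\<^sub>v (e \<cdot>\<^sub>v col W 0) = e \<cdot>\<^sub>v (transpose_mat W *\<^sub>v col W 0)"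
    using W(1) by (intro mult_mat_vec[of _ "Suc m" "Suc m"] carrier_vecI) auto
  also have "transpose_mat W *\<^sub>v col W 0 = unit_vec (Suc m) 0"
    using W(1,2) col_mult2[of "transpose_mat W" "Suc m" "Suc m" W "Suc m" 0] by simp
  finally have colB: "col B 0 = e \<cdot>\<^sub>v unit_vec (Suc m) 0" .
  have B0: "B $$ (i, 0) = (if i = 0 then e else 0)" if "i < Suc m" for i
  proof -
    have "B $$ (i, 0) = col B 0 $ i" using that B by simp
    then show ?thesis unfolding colB using that by simp
  qed
  define B3 where "B3 = mat m m (\<lambda>(i, j). B $$ (Suc i, Suc j))"
  have B3: "B3 \<in> carrier_mat m m" by (simp add: B3_def)
  have symB3: "transpose_mat B3 = B3"
    by (rule eq_matI) (auto simp: B3_def symB')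
  have Bblock: "B = four_block_mat (mat 1 1 (\<lambda>_. e)) (0\<^sub>m 1 m) (0\<^sub>m m 1) B3"
    using B by (intro eq_matI) (auto simp: B3_def B0 symB'[of 0])
  have "\<exists>Q f. Q \<in> carrier_mat m m \<and> transpose_mat Q * Q = 1\<^sub>m m
    \<and> transpose_mat Q * B3 * Q = mat m m (\<lambda>(i, j). if i = j then f i else (0 :: real))"
  \<comment> \<open>A block of size 0 has no nonzero vector, so the induction hypothesis, which asks
    for an eigenvector, cannot be applied to it.\<close>
  proof (cases "m = 0")
    case True
    then show ?thesis by (intro exI[of _ "1\<^sub>m 0"] exI) auto
  next
    case False
    then obtain w d where "w \<in> carrier_vec m" "w \<noteq> 0\<^sub>v m" "B3 *\<^sub>v w = d \<cdot>\<^sub>v w"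
      using symmetric_real_eigenvector[OF B3 symB3] by auto
    from Suc.IH[OF B3 symB3 this] show ?thesis by (elim exE conjE) (intro exI conjI)
  qed
  then obtain P f where P: "P \<in> carrier_mat m m" "transpose_mat P * P = 1\<^sub>m m"
    and Pf: "transpose_mat P * B3 * P = mat m m (\<lambda>(i, j). if i = j then f i else 0)"
    by (elim exE conjE)
  define R where "R = four_block_mat (1\<^sub>m 1) (0\<^sub>m 1 m) (0\<^sub>m m 1) P"
  have R: "R \<in> carrier_mat (Suc m) (Suc m)" unfolding R_def using P by (intro carrier_matI) auto
  have RT: "transpose_mat R = four_block_mat (1\<^sub>m 1) (0\<^sub>m 1 m) (0\<^sub>m m 1) (transpose_mat P)"
    unfolding R_def using P by (subst transpose_four_block_mat[of _ 1 1 _ m _ m]) auto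
  have RR: "transpose_mat R * R = 1\<^sub>m (Suc m)"
    unfolding RT unfolding R_def using P
    by (subst mult_four_block_mat[of _ 1 1 _ m _ m _ _ 1 _ m]) auto
  have "transpose_mat R * B * R
    = four_block_mat (mat 1 1 (\<lambda>_. e)) (0\<^sub>m 1 m) (0\<^sub>m m 1) (transpose_mat P * B3 * P)"
    unfolding RT Bblock unfolding R_def using P B3
    by (subst mult_four_block_mat[of _ 1 1 _ m _ m _ _ 1 _ m] | simp)+
  also have "\<dots> = mat (Suc m) (Suc m) (\<lambda>(i, j). if i = j then case_nat e f i else 0)"
    unfolding Pf by (rule eq_matI) (auto split: nat.splits)
  finally have RBR: "transpose_mat R * B * R = \<dots>" .
  define Q where "Q = W * R"
  have Q: "Q \<in> carrier_mat (Suc m) (Suc m)" using W R by (simp add: Q_def)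
  have QT: "transpose_mat Q = transpose_mat R * transpose_mat W"
    unfolding Q_def using W R by (intro transpose_mult) auto
  have "transpose_mat Q * Q = transpose_mat R * (transpose_mat W * W) * R"
    unfolding QT unfolding Q_def using W(1) R by (simp add: assoc_mult_mat[of _ "Suc m" "Suc m" _ "Suc m" _ "Suc m"])
  then have QQ: "transpose_mat Q * Q = 1\<^sub>m (Suc m)" using W R RR by simp
  have QAQ: "transpose_mat Q * A * Q = transpose_mat R * B * R"
    unfolding QT unfolding Q_def B_def using W(1) R A by (simp add: assoc_mult_mat[of _ "Suc m" "Suc m" _ "Suc m" _ "Suc m"])
  have "col R 0 = unit_vec (Suc m) 0"
    using P by (intro eq_vecI) (auto simp: R_def)
  then have "col Q 0 = col W 0"
    unfolding Q_def using W(1) R col_mult2[of W "Suc m" "Suc m" R "Suc m" 0]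
    by (simp add: mult_mat_unit_vec)
  then have Q0: "col Q 0 = c \<cdot>\<^sub>v v" using W(4) by simp
  have QAQ': "transpose_mat Q * A * Q
    = mat (Suc m) (Suc m) (\<lambda>(i, j). if i = j then case_nat e f i else 0)"
    unfolding QAQ by (rule RBR)
  show ?case
    by (rule exI[of _ Q], rule exI[of _ c], rule exI[of _ "case_nat e f"])
      (intro conjI Q QQ W(3) Q0 QAQ' nat.case(1))
qed

text \<open>An upper bound \<open>a\<close> sorts to the very end, so dropping one copy of it leaves
  the maximum of \<open>xs\<close> on top. Further copies of \<open>a\<close> inside
  \<open>xs\<close> are allowed, which accounts for a repeated top eigenvalue.\<close>

lemma second_of_rev_sort:
  fixes xs :: "'a::linorder list"
  assumes "xs \<noteq> []" "\<And>x. x \<in> set xs \<Longrightarrow> x \<le> a"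
  shows "rev (sorted_list_of_multiset (mset (a # xs))) ! 1 = Max (set xs)"
proof -
  have "sort (a # xs) = sort xs @ [a]"
    by (rule properties_for_sort) (use assms in \<open>auto simp: sorted_append\<close>)
  then have "rev (sorted_list_of_multiset (mset (a # xs))) ! 1 = rev (sort xs) ! 0"
    by (simp only: sorted_list_of_multiset_mset) simp
  moreover have ne: "sort xs \<noteq> []"
  proof
    assume "sort xs = []"
    then have "set (sort xs) = {}" by simp
    then show False using assms(1) by simp
  qed
  ultimately have "rev (sorted_list_of_multiset (mset (a # xs))) ! 1 = last (sort xs)"
    using hd_rev[of "sort xs"] hd_conv_nth[of "rev (sort xs)"] by simp
  also have "\<dots> = Max (set xs)"
  proof (rule Max_eqI[symmetric])
    show "last (sort xs) \<in> set xs" using last_in_set[OF ne] by simp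
    fix y assume "y \<in> set xs"
    then have "y \<in> set (sort xs)" by simp
    then obtain i where "i < length xs" "y = sort xs ! i"
      unfolding in_set_conv_nth by auto
    then show "y \<le> last (sort xs)"
      using ne by (simp add: last_conv_nth sorted_nth_mono)
  qed simp
  finally show ?thesis .
qed

text \<open>In eigencoordinates the form is \<Sum> f i * y_i^2, and orthogonality to
  \<open>v\<close> means y_0 = 0. Removing the eigenvalue \<open>f 0 = 1\<close> once from the
  spectrum leaves the maximum of the other \<open>f i\<close>, which bounds the form on this
  hyperplane and is attained at a column of \<open>Q\<close>.\<close>

lemma lambda_nt_symmetric:
  fixes A :: "real mat"
  assumes A: "A \<in> carrier_mat n n" "transpose_mat A = A" and n: "n \<ge> 2"
    and v: "v \<in> carrier_vec n" "v \<noteq> 0\<^sub>v n" "A *\<^sub>v v = v"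
    and le: "\<And>x. x \<in> carrier_vec n \<Longrightarrow> x \<bullet> (A *\<^sub>v x) \<le> x \<bullet> x"
  shows "x \<in> carrier_vec n \<Longrightarrow> x \<bullet> v = 0 \<Longrightarrow> x \<bullet> (A *\<^sub>v x) \<le> lambda_nt A * (x \<bullet> x)"
    and "\<exists>x. x \<in> carrier_vec n \<and> x \<noteq> 0\<^sub>v n \<and> x \<bullet> v = 0 \<and> A *\<^sub>v x = lambda_nt A \<cdot>\<^sub>v x"
proof -
  obtain Q c f where Q: "Q \<in> carrier_mat n n" "transpose_mat Q * Q = 1\<^sub>m n" and c: "c \<noteq> 0"
    and Q0: "col Q 0 = c \<cdot>\<^sub>v v" and f0: "f 0 = 1"
    and D: "transpose_mat Q * A * Q = mat n n (\<lambda>(i, j). if i = j then f i else 0)"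
    using symmetric_real_diagonalization[OF A v(1,2), of 1] v(3) by (simp, elim exE conjE)
  define D where "D = mat n n (\<lambda>(i, j). if i = j then f i else 0)"
  have Dc: "D \<in> carrier_mat n n" by (simp add: D_def)
  have QQ: "Q * transpose_mat Q = 1\<^sub>m n"
    using Q mat_mult_left_right_inverse[of "transpose_mat Q" n Q] by simp
  have Dy: "D *\<^sub>v y = vec n (\<lambda>i. f i * y $ i)" if "y \<in> carrier_vec n" for y
  proof (rule eq_vecI)
    fix i assume "i < dim_vec (vec n (\<lambda>i. f i * y $ i))"
    then have i: "i < n" by simp
    have "(D *\<^sub>v y) $ i = (\<Sum>j=0..<n. (if i = j then f i else 0) * y $ j)"
      using i that by (simp add: D_def scalar_prod_def)
    also have "\<dots> = (\<Sum>j=0..<n. if i = j then f i * y $ j else 0)"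
      by (intro sum.cong) auto
    finally have "(D *\<^sub>v y) $ i = (\<Sum>j=0..<n. if i = j then f i * y $ j else 0)" .
    then show "(D *\<^sub>v y) $ i = vec n (\<lambda>i. f i * y $ i) $ i" using i by simp
  qed (simp add: D_def)
  have QDQ: "A = Q * D * transpose_mat Q"
  proof -
    have "Q * D * transpose_mat Q = (Q * transpose_mat Q) * A * (Q * transpose_mat Q)"
      unfolding D_def D[symmetric] using Q(1) A(1)
      by (simp add: assoc_mult_mat[of _ n n _ n _ n])
    then show ?thesis using A(1) by (simp add: QQ)
  qed
  have AQ: "A *\<^sub>v (Q *\<^sub>v y) = Q *\<^sub>v (D *\<^sub>v y)" if y: "y \<in> carrier_vec n" for y
  proof -
    have "A *\<^sub>v (Q *\<^sub>v y) = Q *\<^sub>v (D *\<^sub>v ((transpose_mat Q * Q) *\<^sub>v y))"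
      using Q(1) Dc y by (subst QDQ) (simp add: assoc_mult_mat_vec[of _ n n _ n])
    then show ?thesis using y Q(2) by simp
  qed
  have QxQy: "(Q *\<^sub>v x) \<bullet> (Q *\<^sub>v y) = x \<bullet> y"
    if x: "x \<in> carrier_vec n" and y: "y \<in> carrier_vec n" for x y
  proof -
    have "(Q *\<^sub>v x) \<bullet> (Q *\<^sub>v y) = (transpose_mat Q *\<^sub>v (Q *\<^sub>v x)) \<bullet> y"
      using transpose_vec_mult_scalar[OF Q(1) y, of "Q *\<^sub>v x"] Q(1) x y
      by simp
    also have "transpose_mat Q *\<^sub>v (Q *\<^sub>v x) = (transpose_mat Q * Q) *\<^sub>v x"
      using Q(1) x by (simp add: assoc_mult_mat_vec[of _ n n _ n])
    finally show ?thesis using Q(2) x by simp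
  qed
  have sq: "y \<bullet> y = (\<Sum>i<n. (y $ i)\<^sup>2)" and
    dsq: "y \<bullet> (D *\<^sub>v y) = (\<Sum>i<n. f i * (y $ i)\<^sup>2)" if "y \<in> carrier_vec n" for y
    using that by (auto simp: Dy) (auto simp: scalar_prod_def power2_eq_square lessThan_atLeast0 intro!: sum.cong)
  have Qv: "(Q *\<^sub>v y) \<bullet> v = y $ 0 / c" if y: "y \<in> carrier_vec n" for y
  proof -
    have "c * ((Q *\<^sub>v y) \<bullet> v) = (Q *\<^sub>v y) \<bullet> (Q *\<^sub>v unit_vec n 0)"
      using Q(1) Q0 n v(1) y by (simp add: mult_mat_unit_vec)
    also have "\<dots> = y $ 0" using y n by (simp add: QxQy)
    finally show ?thesis using c by (simp add: field_simps)
  qed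
  \<comment> \<open>Testing \<open>le\<close> on column \<open>i\<close> of \<open>Q\<close>, whose
    Rayleigh quotient is \<open>f i\<close>, shows that \<open>f 0 = 1\<close> is a largest
    eigenvalue.\<close>
  have f_le: "f i \<le> 1" if i: "i < n" for i
  proof -
    have u: "unit_vec n i \<in> carrier_vec n" by simp
    have "unit_vec n i \<bullet> (D *\<^sub>v unit_vec n i) = f i" using i by (simp add: Dy)
    then show ?thesis
      using le[of "Q *\<^sub>v unit_vec n i"] Q(1) Dc i by (simp add: AQ[OF u] QxQy)
  qed
  have sim: "similar_mat A D"
    unfolding similar_mat_def
    by (intro exI) (rule similar_mat_witI[OF QQ Q(2) QDQ A(1) Dc], use Q in auto)
  \<comment> \<open>Similarity to a diagonal matrix splits the characteristic polynomial over the
    reals, so \<open>proots\<close> lists every \<open>f i\<close> with its multiplicity.\<close>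
  have "char_poly A = (\<Prod>a\<leftarrow>diag_mat D. [:- a, 1:])"
    unfolding char_poly_similar[OF sim]
    by (intro char_poly_upper_triangular[OF Dc]) (simp add: upper_triangular_def D_def)
  also have "diag_mat D = map f [0..<n]" by (simp add: diag_mat_def D_def)
  also have "map f [0..<n] = 1 # map f [1..<n]" using n f0 upt_conv_Cons[of 0 n] by simp
  finally have "proots (char_poly A) = proots (\<Prod>a\<leftarrow>1 # map f [1..<n]. [:- a, 1:])" by simp
  also have "proots (\<Prod>a\<leftarrow>xs. [:- a, 1:]) = mset xs" for xs :: "real list"
  proof (induction xs)
    case (Cons a xs)
    have "(\<Prod>a\<leftarrow>xs. [:- a, 1:]) \<noteq> 0" by auto
    with Cons show ?case by (simp add: proots_mult del: mult_pCons_left)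
  qed simp
  finally have pr: "proots (char_poly A) = mset (1 # map f [1..<n])" .
  have lam: "lambda_nt A = Max (f ` {1..<n})"
    unfolding lambda_nt_def eigs_desc_def pr
    by (subst second_of_rev_sort) (use f_le n in auto)
  show "x \<bullet> (A *\<^sub>v x) \<le> lambda_nt A * (x \<bullet> x)" if x: "x \<in> carrier_vec n" "x \<bullet> v = 0" for x
  proof -
    define y where "y = transpose_mat Q *\<^sub>v x"
    have y: "y \<in> carrier_vec n"
      using Q(1) x(1) unfolding y_def by (intro mult_mat_vec_carrier[of _ n n]) auto
    have xy: "x = Q *\<^sub>v y"
      using Q(1) QQ x(1) assoc_mult_mat_vec[of Q n n "transpose_mat Q" n x] by (simp add: y_def)
    have y0: "y $ 0 = 0" using Qv[OF y] x(2) c by (simp add: xy)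
    have "x \<bullet> (A *\<^sub>v x) = (\<Sum>i<n. f i * (y $ i)\<^sup>2)"
      unfolding xy AQ[OF y] using y Dc by (simp add: QxQy dsq)
    \<comment> \<open>Index 0 is the only one where \<open>f i\<close> may exceed
      \<open>lambda_nt A\<close>, and its coordinate vanishes.\<close>
    also have "\<dots> \<le> (\<Sum>i<n. lambda_nt A * (y $ i)\<^sup>2)"
    proof (intro sum_mono)
      fix i assume "i \<in> {..<n}"
      then show "f i * (y $ i)\<^sup>2 \<le> lambda_nt A * (y $ i)\<^sup>2"
        by (cases "i = 0") (auto simp: y0 lam intro!: mult_right_mono Max_ge)
    qed
    also have "\<dots> = lambda_nt A * (x \<bullet> x)"
      using y by (simp add: xy QxQy sq sum_distrib_left)
    finally show ?thesis .
  qed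
  have "lambda_nt A \<in> f ` {1..<n}" unfolding lam by (rule Max_in) (use n in auto)
  then obtain k where k: "1 \<le> k" "k < n" "lambda_nt A = f k" by auto
  have u: "unit_vec n k \<in> carrier_vec n" by simp
  have "D *\<^sub>v unit_vec n k = f k \<cdot>\<^sub>v unit_vec n k"
    using k by (auto simp: Dy intro!: eq_vecI)
  then have 1: "A *\<^sub>v (Q *\<^sub>v unit_vec n k) = lambda_nt A \<cdot>\<^sub>v (Q *\<^sub>v unit_vec n k)"
    using AQ[OF u] mult_mat_vec[OF Q(1) u] k by simp
  have 2: "(Q *\<^sub>v unit_vec n k) \<bullet> v = 0" using Qv[OF u] k by simp
  have 3: "Q *\<^sub>v unit_vec n k \<noteq> 0\<^sub>v n"
  proof
    assume "Q *\<^sub>v unit_vec n k = 0\<^sub>v n"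
    then show False using QxQy[OF u u] k by simp
  qed
  have 4: "Q *\<^sub>v unit_vec n k \<in> carrier_vec n"
    using Q(1) by (intro mult_mat_vec_carrier[of _ n n]) auto
  show "\<exists>x. x \<in> carrier_vec n \<and> x \<noteq> 0\<^sub>v n \<and> x \<bullet> v = 0 \<and> A *\<^sub>v x = lambda_nt A \<cdot>\<^sub>v x"
    by (rule exI[of _ "Q *\<^sub>v unit_vec n k"], intro conjI 1 2 3 4)
qed

section \<open>Normalized adjacency operators\<close>

lemma enum_set:
  assumes "finite V"
  shows distinct_enum_set: "distinct (enum_set V)" and set_enum_set: "set (enum_set V) = V"
    and length_enum_set: "length (enum_set V) = card V"
proof -
  have "distinct (enum_set V) \<and> set (enum_set V) = V"
    unfolding enum_set_def by (rule someI_ex) (metis assms finite_distinct_list)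
  then show "distinct (enum_set V)" "set (enum_set V) = V" "length (enum_set V) = card V"
    using distinct_card by metis+
qed

lemma bij_betw_enum_set: "finite V \<Longrightarrow> bij_betw ((!) (enum_set V)) {..<card V} V"
  using bij_betw_nth[OF distinct_enum_set] set_enum_set length_enum_set by (metis (no_types))

lemma sum_enum_set: "finite V \<Longrightarrow> (\<Sum>i<card V. g (enum_set V ! i)) = sum g V"
  using sum.reindex_bij_betw[OF bij_betw_enum_set] .

lemma enum_set_in: "finite V \<Longrightarrow> i < card V \<Longrightarrow> enum_set V ! i \<in> V"
  using bij_betw_enum_set bij_betwE by blast

text \<open>The enumeration is the one that indexes \<open>norm_adj\<close>, so matrices can be
  treated as operators on functions on \<open>V\<close>.\<close>

definition vec_of :: "'v set \<Rightarrow> ('v \<Rightarrow> real) \<Rightarrow> real vec" where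
  "vec_of V f = vec (card V) (\<lambda>i. f (enum_set V ! i))"

lemma vec_of_carrier [simp]: "vec_of V f \<in> carrier_vec (card V)"
  by (simp add: vec_of_def)

lemma vec_of_eq_iff:
  assumes "finite V"
  shows "vec_of V f = vec_of V g \<longleftrightarrow> (\<forall>x\<in>V. f x = g x)"
proof
  assume eq: "vec_of V f = vec_of V g"
  show "\<forall>x\<in>V. f x = g x"
  proof
    fix x assume "x \<in> V"
    then obtain i where "i < card V" "x = enum_set V ! i"
      using bij_betw_enum_set[OF assms] by (auto simp: bij_betw_def)
    then show "f x = g x" using arg_cong[OF eq, of "\<lambda>v. v $ i"] by (simp add: vec_of_def)
  qed
qed (auto simp: vec_of_def enum_set_in[OF assms] intro!: eq_vecI)

lemma scalar_prod_vec_of: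
  "finite V \<Longrightarrow> vec_of V f \<bullet> vec_of V g = (\<Sum>x\<in>V. f x * g x)"
  using sum_enum_set[of V "\<lambda>x. f x * g x"]
  by (simp add: vec_of_def scalar_prod_def lessThan_atLeast0)

lemma vec_of_surj:
  assumes "finite V" "v \<in> carrier_vec (card V)"
  obtains f where "v = vec_of V f"
proof
  have "inj_on ((!) (enum_set V)) {..<card V}"
    using bij_betw_enum_set[OF assms(1)] by (simp add: bij_betw_def)
  then show "v = vec_of V (\<lambda>x. v $ inv_into {..<card V} ((!) (enum_set V)) x)"
    using assms(2) by (intro eq_vecI) (auto simp: vec_of_def)
qed

definition walk_op :: "'v set \<Rightarrow> ('v \<Rightarrow> 'v \<Rightarrow> bool) \<Rightarrow> ('v \<Rightarrow> real) \<Rightarrow> 'v \<Rightarrow> real" where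
  "walk_op V R f x = (\<Sum>y | y \<in> V \<and> R x y. f y) / real (card {y \<in> V. R x y})"

lemma norm_adj_carrier: "finite V \<Longrightarrow> norm_adj V R \<in> carrier_mat (card V) (card V)"
  by (simp add: norm_adj_def Let_def length_enum_set)

lemma norm_adj_mult_vec_of:
  assumes V: "finite V"
  shows "norm_adj V R *\<^sub>v vec_of V f = vec_of V (walk_op V R f)"
proof (rule eq_vecI)
  fix i assume "i < dim_vec (vec_of V (walk_op V R f))"
  then have i: "i < card V" by (simp add: vec_of_def)
  define x where "x = enum_set V ! i"
  have "(norm_adj V R *\<^sub>v vec_of V f) $ i
     = (\<Sum>j<card V. (if R x (enum_set V ! j) then 1 / real (card {y \<in> V. R x y}) else 0)
          * f (enum_set V ! j))"
    using i length_enum_set[OF V] unfolding x_def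
    by (simp add: norm_adj_def Let_def vec_of_def scalar_prod_def lessThan_atLeast0)
  also have "\<dots> = (\<Sum>y\<in>V. (if R x y then 1 / real (card {y \<in> V. R x y}) else 0) * f y)"
    by (rule sum_enum_set[OF V])
  also have "\<dots> = (\<Sum>y\<in>V. if R x y then f y / real (card {y \<in> V. R x y}) else 0)"
    by (intro sum.cong) auto
  also have "\<dots> = walk_op V R f x"
    using V by (simp add: walk_op_def sum_divide_distrib flip: sum.inter_filter)
  finally show "(norm_adj V R *\<^sub>v vec_of V f) $ i = vec_of V (walk_op V R f) $ i"
    using i by (simp add: vec_of_def x_def)
qed (use norm_adj_carrier[OF V, of R] in \<open>simp add: vec_of_def\<close>)

text \<open>On a regular graph D^{-1} A is a scalar multiple of the symmetric matrix A.\<close>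

lemma norm_adj_symmetric:
  assumes V: "finite V" and sym: "\<And>x y. R x y \<Longrightarrow> R y x"
    and reg: "\<And>x. x \<in> V \<Longrightarrow> card {y \<in> V. R x y} = k"
  shows "transpose_mat (norm_adj V R) = norm_adj V R"
  by (rule eq_matI)
    (auto simp: norm_adj_def Let_def reg enum_set_in[OF V] length_enum_set[OF V] dest: sym)

text \<open>The variance of \<open>f\<close> over the neighbours of x is nonnegative, so the square
  of the average is at most the average of the squares. Summing over x counts each vertex
  \<open>k\<close> times, which cancels the division by \<open>k\<close>.\<close>

lemma walk_op_contraction:
  assumes V: "finite V" and sym: "\<And>x y. R x y \<Longrightarrow> R y x"
    and reg: "\<And>x. x \<in> V \<Longrightarrow> card {y \<in> V. R x y} = k" and k: "k > 0"
  shows "(\<Sum>x\<in>V. (walk_op V R f x)\<^sup>2) \<le> (\<Sum>x\<in>V. (f x)\<^sup>2)"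
proof -
  have "(walk_op V R f x)\<^sup>2 \<le> (\<Sum>y | y \<in> V \<and> R x y. (f y)\<^sup>2) / real k" if "x \<in> V" for x
  proof -
    define N where "N = {y \<in> V. R x y}"
    define m where "m = walk_op V R f x"
    have m: "(\<Sum>y\<in>N. f y) = real k * m"
      using k reg[OF that] by (simp add: m_def walk_op_def N_def)
    have "0 \<le> (\<Sum>y\<in>N. (f y - m)\<^sup>2)" by (simp add: sum_nonneg)
    also have "\<dots> = (\<Sum>y\<in>N. (f y)\<^sup>2) - 2 * m * (\<Sum>y\<in>N. f y) + real k * m\<^sup>2"
      using reg[OF that] by (simp add: power2_diff sum.distrib sum_subtractf sum_distrib_left
          N_def mult_ac)
    also have "\<dots> = (\<Sum>y\<in>N. (f y)\<^sup>2) - real k * m\<^sup>2"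
      unfolding m by (simp add: power2_eq_square)
    finally show ?thesis using k by (simp add: m_def N_def field_simps)
  qed
  then have "(\<Sum>x\<in>V. (walk_op V R f x)\<^sup>2) \<le> (\<Sum>x\<in>V. (\<Sum>y | y \<in> V \<and> R x y. (f y)\<^sup>2) / real k)"
    by (rule sum_mono)
  also have "\<dots> = (\<Sum>x\<in>V. \<Sum>y | y \<in> V \<and> R x y. (f y)\<^sup>2) / real k"
    by (simp add: sum_divide_distrib)
  also have "(\<Sum>x\<in>V. \<Sum>y | y \<in> V \<and> R x y. (f y)\<^sup>2) = (\<Sum>y\<in>V. \<Sum>x | x \<in> V \<and> R x y. (f y)\<^sup>2)"
    using V V by (rule sum.swap_restrict)
  also have "\<dots> = (\<Sum>y\<in>V. real k * (f y)\<^sup>2)"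
  proof (rule sum.cong[OF refl])
    fix y assume "y \<in> V"
    moreover have "{x \<in> V. R x y} = {x \<in> V. R y x}" using sym by blast
    ultimately show "(\<Sum>x | x \<in> V \<and> R x y. (f y)\<^sup>2) = real k * (f y)\<^sup>2" using reg by simp
  qed
  also have "\<dots> / real k = (\<Sum>x\<in>V. (f x)\<^sup>2)" using k by (simp add: sum_divide_distrib)
  finally show ?thesis .
qed

text \<open>Turns a norm bound on an operator into the bound on its quadratic form that
  \<open>lambda_nt_symmetric_op\<close> requires; the pointwise inequality 2uv \<le> u^2 + v^2
  suffices.\<close>

lemma sum_mult_le_sum_squares:
  fixes f g :: "'a \<Rightarrow> real"
  assumes "(\<Sum>x\<in>V. (g x)\<^sup>2) \<le> (\<Sum>x\<in>V. (f x)\<^sup>2)"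
  shows "(\<Sum>x\<in>V. f x * g x) \<le> (\<Sum>x\<in>V. (f x)\<^sup>2)"
proof -
  have "f x * g x \<le> (f x)\<^sup>2 / 2 + (g x)\<^sup>2 / 2" for x
    using sum_squares_bound[of "f x" "g x"] by simp
  then have "(\<Sum>x\<in>V. f x * g x) \<le> (\<Sum>x\<in>V. (f x)\<^sup>2 / 2 + (g x)\<^sup>2 / 2)"
    by (intro sum_mono)
  also have "\<dots> = (\<Sum>x\<in>V. (f x)\<^sup>2) / 2 + (\<Sum>x\<in>V. (g x)\<^sup>2) / 2"
    by (simp add: sum.distrib sum_divide_distrib)
  finally show ?thesis using assms by simp
qed

text \<open>Index-free version with the constant function as trivial eigenvector, so that
  orthogonality becomes mean zero. The Rayleigh bound serves the zig-zag operator, the eigenfunction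
  the walk on edges.\<close>

lemma lambda_nt_symmetric_op:
  assumes V: "finite V" "card V \<ge> 2"
    and M: "M \<in> carrier_mat (card V) (card V)" "transpose_mat M = M"
    and op: "\<And>f. M *\<^sub>v vec_of V f = vec_of V (P f)"
    and one: "\<And>x. x \<in> V \<Longrightarrow> P (\<lambda>_. 1) x = 1"
    and le: "\<And>f. (\<Sum>x\<in>V. f x * P f x) \<le> (\<Sum>x\<in>V. (f x)\<^sup>2)"
  shows lambda_nt_rayleigh:
      "(\<Sum>x\<in>V. f x) = 0 \<Longrightarrow> (\<Sum>x\<in>V. f x * P f x) \<le> lambda_nt M * (\<Sum>x\<in>V. (f x)\<^sup>2)"
    and lambda_nt_eigenfunction:
      "\<exists>f. (\<exists>x\<in>V. f x \<noteq> 0) \<and> (\<Sum>x\<in>V. f x) = 0 \<and> (\<forall>x\<in>V. P f x = lambda_nt M * f x)"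
proof -
  let ?v = "vec_of V (\<lambda>_. 1)"
  have zero: "0\<^sub>v (card V) = vec_of V (\<lambda>_. 0)" by (auto simp: vec_of_def)
  obtain x0 where "x0 \<in> V" using V by fastforce
  then have v: "?v \<noteq> 0\<^sub>v (card V)" unfolding zero vec_of_eq_iff[OF V(1)] by auto
  have Mv: "M *\<^sub>v ?v = ?v" unfolding op vec_of_eq_iff[OF V(1)] using one by simp
  have le': "x \<bullet> (M *\<^sub>v x) \<le> x \<bullet> x" if "x \<in> carrier_vec (card V)" for x
  proof -
    obtain g where "x = vec_of V g" using vec_of_surj[OF V(1) \<open>x \<in> _\<close>] .
    then show ?thesis using le[of g] by (simp add: op scalar_prod_vec_of[OF V(1)] power2_eq_square)
  qed
  note L = lambda_nt_symmetric[OF M V(2) vec_of_carrier v Mv]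
  show "(\<Sum>x\<in>V. f x * P f x) \<le> lambda_nt M * (\<Sum>x\<in>V. (f x)\<^sup>2)" if "(\<Sum>x\<in>V. f x) = 0"
  proof -
    have "vec_of V f \<bullet> (M *\<^sub>v vec_of V f) \<le> lambda_nt M * (vec_of V f \<bullet> vec_of V f)"
      by (rule L(1), rule le') (simp_all add: that scalar_prod_vec_of[OF V(1)])
    then show ?thesis by (simp add: op scalar_prod_vec_of[OF V(1)] power2_eq_square)
  qed
  have "\<exists>x. x \<in> carrier_vec (card V) \<and> x \<noteq> 0\<^sub>v (card V) \<and> x \<bullet> ?v = 0 \<and> M *\<^sub>v x = lambda_nt M \<cdot>\<^sub>v x"
    by (rule L(2), rule le')
  then obtain x where x: "x \<in> carrier_vec (card V)" "x \<noteq> 0\<^sub>v (card V)" "x \<bullet> ?v = 0"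
    "M *\<^sub>v x = lambda_nt M \<cdot>\<^sub>v x" by (elim exE conjE)
  obtain g where g: "x = vec_of V g" using vec_of_surj[OF V(1) x(1)] .
  have "lambda_nt M \<cdot>\<^sub>v vec_of V g = vec_of V (\<lambda>x. lambda_nt M * g x)"
    by (auto simp: vec_of_def)
  then have 1: "\<forall>x\<in>V. P g x = lambda_nt M * g x"
    using x(4) unfolding g op by (simp add: vec_of_eq_iff[OF V(1)])
  have 2: "\<exists>x\<in>V. g x \<noteq> 0"
    using x(2) unfolding g zero vec_of_eq_iff[OF V(1)] by simp
  have 3: "(\<Sum>x\<in>V. g x) = 0"
    using x(3) unfolding g by (simp add: scalar_prod_vec_of[OF V(1)])
  show "\<exists>f. (\<exists>x\<in>V. f x \<noteq> 0) \<and> (\<Sum>x\<in>V. f x) = 0 \<and> (\<forall>x\<in>V. P f x = lambda_nt M * f x)"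
    by (rule exI[of _ g], intro conjI 1 2 3)
qed

lemma walk_op_cong:
  "(\<And>y. y \<in> V \<Longrightarrow> f y = g y) \<Longrightarrow> walk_op V R f x = walk_op V R g x"
  unfolding walk_op_def by (rule arg_cong2[of _ _ _ _ "(/)"]) (auto intro: sum.cong)

lemma walk_op_one:
  "card {y \<in> V. R x y} > 0 \<Longrightarrow> walk_op V R (\<lambda>_. 1) x = 1"
  by (simp add: walk_op_def)

lemma walk_op_selfadjoint:
  assumes V: "finite V" and sym: "\<And>x y. R x y \<Longrightarrow> R y x"
    and reg: "\<And>x. x \<in> V \<Longrightarrow> card {y \<in> V. R x y} = k"
  shows "(\<Sum>x\<in>V. f x * walk_op V R g x) = (\<Sum>x\<in>V. walk_op V R f x * g x)"
proof -
  have "(\<Sum>x\<in>V. f x * walk_op V R g x) = (\<Sum>x\<in>V. \<Sum>y | y \<in> V \<and> R x y. f x * g y / real k)"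
    by (intro sum.cong refl) (simp add: walk_op_def reg sum_distrib_left sum_divide_distrib)
  also have "\<dots> = (\<Sum>y\<in>V. \<Sum>x | x \<in> V \<and> R x y. f x * g y / real k)"
    using V V by (rule sum.swap_restrict)
  also have "\<dots> = (\<Sum>y\<in>V. walk_op V R f y * g y)"
  proof (rule sum.cong[OF refl])
    fix y assume "y \<in> V"
    moreover have "{x \<in> V. R x y} = {x \<in> V. R y x}" using sym by blast
    ultimately show "(\<Sum>x | x \<in> V \<and> R x y. f x * g y / real k) = walk_op V R f y * g y"
      by (simp add: walk_op_def reg sum_distrib_right sum_divide_distrib)
  qed
  finally show ?thesis .
qed

text \<open>Each triangle through \<open>e\<close> contributes its two other edges. Two distinct
  edges of a triangle cover it, so a neighbour \<open>e'\<close> determines the triangle as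
  \<open>e \<union> e'\<close> and nothing is counted twice.\<close>

lemma card_walk_neighbours:
  assumes X: "finite X" "\<And>t. t \<in> X \<Longrightarrow> card t = 3" and e: "card e = 2"
  shows "card {e' \<in> cx_edges X. walk_rel X e e'} = 2 * card {t \<in> X. e \<subseteq> t}"
proof -
  define N where "N t = {e'. e' \<subseteq> t \<and> card e' = 2} - {e}" for t
  have fin: "finite t" if "t \<in> X" for t using X(2)[OF that] by (simp add: card_ge_0_finite)
  have "{e' \<in> cx_edges X. walk_rel X e e'} = (\<Union>t\<in>{t \<in> X. e \<subseteq> t}. N t)"
    by (auto simp: cx_edges_def walk_rel_def N_def)
  also have "card \<dots> = (\<Sum>t\<in>{t \<in> X. e \<subseteq> t}. card (N t))"
  proof (rule card_UN_disjoint)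
    show "\<forall>t\<in>{t \<in> X. e \<subseteq> t}. finite (N t)" using fin by (simp add: N_def)
    have "t = e \<union> e'" if "t \<in> X" "e \<subseteq> t" "e' \<in> N t" for t e'
    proof -
      have f: "finite e" "finite e'" "e' \<subseteq> t" "card e' = 2" "e' \<noteq> e"
        using that fin[OF that(1)] by (auto simp: N_def intro: finite_subset)
      have "e \<subset> e \<union> e'" using f e by (metis Un_upper1 card_subset_eq psubsetI sup.absorb_iff1 sup_commute)
      then have "card e < card (e \<union> e')" using f by (intro psubset_card_mono) auto
      then show ?thesis using card_seteq[of t "e \<union> e'"] fin[OF that(1)] X(2)[OF that(1)] that f e by auto
    qed
    then show "\<forall>t\<in>{t \<in> X. e \<subseteq> t}. \<forall>t'\<in>{t \<in> X. e \<subseteq> t}. t \<noteq> t' \<longrightarrow> N t \<inter> N t' = {}" by blast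
  qed (use X in simp)
  also have "\<dots> = (\<Sum>t\<in>{t \<in> X. e \<subseteq> t}. 2)"
  proof (rule sum.cong[OF refl])
    fix t assume "t \<in> {t \<in> X. e \<subseteq> t}"
    then have t: "t \<in> X" "e \<subseteq> t" by auto
    have "card {e'. e' \<subseteq> t \<and> card e' = 2} = 3"
      using n_subsets[OF fin[OF t(1)], of 2] X(2)[OF t(1)] by (simp add: choose_two)
    then show "card (N t) = 2" using t e by (simp add: N_def)
  qed
  finally show ?thesis by simp
qed

section \<open>The two-to-one cover of the edges of Sc[S, G]\<close>

locale cts = group G for G :: "('g, 'b) monoid_scheme" (structure) +
  fixes S :: "'g set set"
  assumes fin: "finite (carrier G)" and cx: "is_2complex_on G S" and cts: "CTS G S"
begin

abbreviation "V \<equiv> carrier G \<times> cx_edges S"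
abbreviation "C \<equiv> Sc S G"
abbreviation "B \<equiv> blue_step G"

definition proj :: "'g \<times> 'g set \<Rightarrow> 'g set" where
  "proj x = rtrans G (snd x) (fst x)"

definition N :: "'g \<times> 'g set \<Rightarrow> ('g \<times> 'g set) set" where
  "N x = {y \<in> V. red_rel S x y}"

lemma triangle: "t \<in> S \<Longrightarrow> card t = 3" "t \<in> S \<Longrightarrow> t \<subseteq> carrier G"
  using cx by (auto simp: is_2complex_on_def)

lemma finite_S: "finite S"
  by (rule finite_subset[of _ "Pow (carrier G)"]) (use triangle fin in auto)

lemma edge_carrier: "e \<in> cx_edges S \<Longrightarrow> e \<subseteq> carrier G"
  using triangle by (auto simp: cx_edges_def)

lemma edge_comm: "{a, b} \<in> cx_edges S \<Longrightarrow> a \<otimes> b = b \<otimes> a"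
  using cts unfolding CTS_def by blast

lemma edge_inv:
  assumes "{a, b} \<in> cx_edges S"
  shows "{inv a, inv b} \<in> cx_edges S"
  using cts edge_carrier[OF assms] assms unfolding CTS_def by blast

lemma edge_quotient:
  assumes "{a, b} \<in> cx_edges S" "{c, d} \<in> cx_edges S" "a \<otimes> inv b = c \<otimes> inv d"
  shows "(a, b) = (c, d) \<or> d = inv a \<and> c = inv b"
  using cts assms unfolding CTS_def by blast

lemma edge_ne: "{a, b} \<in> cx_edges S \<Longrightarrow> a \<noteq> b"
  by (auto simp: cx_edges_def)

text \<open>Condition (0) enters here. As a consequence the blue step moves the group component,
  hence has no fixed point.\<close>

lemma edge_mult_ne_one:
  assumes "{a, b} \<in> cx_edges S"
  shows "a \<otimes> b \<noteq> \<one>"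
proof
  assume "a \<otimes> b = \<one>"
  moreover have "a \<in> carrier G" "b \<in> carrier G" using edge_carrier[OF assms] by auto
  ultimately have "b = inv a" using edge_comm[OF assms] by (metis inv_equality)
  moreover have "a \<in> \<Union>S" using assms by (auto simp: cx_edges_def)
  ultimately show False using cts assms unfolding CTS_def by blast
qed

lemma edge_prod: 
  assumes "{a, b} \<in> cx_edges S"
  shows "edge_prod G {a, b} = a \<otimes> b"
  unfolding edge_prod_def
proof (rule some_equality)
  show "\<exists>a' b'. {a, b} = {a', b'} \<and> a' \<noteq> b' \<and> a \<otimes> b = a' \<otimes> b'"
    using edge_ne[OF assms] by blast
  show "p = a \<otimes> b" if "\<exists>a' b'. {a, b} = {a', b'} \<and> a' \<noteq> b' \<and> p = a' \<otimes> b'" for p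
    using that edge_comm[OF assms] by (auto simp: doubleton_eq_iff)
qed

section \<open>The blue involution and the fibres of the cover\<close>

lemma V_cases:
  assumes "x \<in> V"
  obtains g a b where "x = (g, {a, b})" "g \<in> carrier G" "a \<in> carrier G" "b \<in> carrier G"
    "{a, b} \<in> cx_edges S"
proof -
  obtain g e where x: "x = (g, e)" "g \<in> carrier G" "e \<in> cx_edges S" using assms by auto
  then obtain a b where "e = {a, b}" by (auto simp: cx_edges_def card_2_iff)
  then show thesis using that x edge_carrier[OF x(3)] by auto
qed

lemma blue_step_pair:
  "{a, b} \<in> cx_edges S \<Longrightarrow> B (g, {a, b}) = (a \<otimes> b \<otimes> g, {inv a, inv b})"
  by (simp add: blue_step_def edge_prod)

lemma blue_in: assumes "x \<in> V" shows "B x \<in> V"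
  using assms by (rule V_cases) (simp add: blue_step_pair edge_inv)

lemma blue_blue: assumes "x \<in> V" shows "B (B x) = x"
  using assms
proof (rule V_cases)
  fix g a b assume x: "x = (g, {a, b})" "g \<in> carrier G" "a \<in> carrier G" "b \<in> carrier G"
    "{a, b} \<in> cx_edges S"
  \<comment> \<open>Inversion reverses products; commutativity restores the order, so the second
    blue step translates by the inverse of the first translation.\<close>
  have "inv a \<otimes> inv b = inv (a \<otimes> b)"
    using x edge_comm[OF x(5)] by (simp add: inv_mult_group)
  moreover have "inv (a \<otimes> b) \<otimes> (a \<otimes> b \<otimes> g) = g"
    using x by (subst m_assoc[symmetric]) simp_all
  ultimately have "inv a \<otimes> inv b \<otimes> (a \<otimes> b \<otimes> g) = g" by simp
  then show ?thesis using x by (simp add: blue_step_pair edge_inv)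
qed

lemma fst_blue_ne: assumes "x \<in> V" shows "fst (B x) \<noteq> fst x"
  using assms
proof (rule V_cases)
  fix g a b assume x: "x = (g, {a, b})" "g \<in> carrier G" "a \<in> carrier G" "b \<in> carrier G"
    "{a, b} \<in> cx_edges S"
  then show ?thesis using edge_mult_ne_one[OF x(5)] r_cancel_one[of g "a \<otimes> b"]
    by (simp add: blue_step_pair)
qed

lemma proj_pair: "proj (g, {a, b}) = {a \<otimes> g, b \<otimes> g}"
  by (simp add: proj_def rtrans_def)

text \<open>The blue step exchanges the endpoints: inv a takes abg to bg, and since ab = ba, inv b
  takes it to ag.\<close>

lemma proj_blue: assumes "x \<in> V" shows "proj (B x) = proj x"
  using assms
proof (rule V_cases)
  fix g a b assume x: "x = (g, {a, b})" "g \<in> carrier G" "a \<in> carrier G" "b \<in> carrier G"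
    "{a, b} \<in> cx_edges S"
  have "inv a \<otimes> (a \<otimes> b \<otimes> g) = b \<otimes> g" using x by (simp add: m_assoc[symmetric])
  moreover have "inv b \<otimes> (a \<otimes> b \<otimes> g) = a \<otimes> g"
    unfolding edge_comm[OF x(5)] using x by (simp add: m_assoc[symmetric])
  ultimately show ?thesis using x by (simp add: blue_step_pair proj_pair insert_commute)
qed

text \<open>The quotient of the two endpoints is unchanged by right translation, so equal endpoints
  give equal quotients of the original pairs. Condition (D) then leaves the same pair or the
  inverted and swapped one, and the latter is the blue partner.\<close>

lemma translated_edges_eq:
  assumes e: "{a, b} \<in> cx_edges S" "{c, d} \<in> cx_edges S" and g: "g \<in> carrier G" "h \<in> carrier G"
    and eq: "a \<otimes> g = c \<otimes> h" "b \<otimes> g = d \<otimes> h"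
  shows "(h, {c, d}) = (g, {a, b}) \<or> (h, {c, d}) = B (g, {a, b})"
proof -
  have car: "a \<in> carrier G" "b \<in> carrier G" "c \<in> carrier G" "d \<in> carrier G"
    using edge_carrier[OF e(1)] edge_carrier[OF e(2)] by auto
  have cancel: "u \<otimes> k \<otimes> inv (v \<otimes> k) = u \<otimes> inv v"
    if "u \<in> carrier G" "v \<in> carrier G" "k \<in> carrier G" for u v k
  proof -
    have "u \<otimes> k \<otimes> inv (v \<otimes> k) = u \<otimes> (k \<otimes> inv k) \<otimes> inv v"
      using that by (simp only: inv_mult_group m_assoc m_closed inv_closed)
    then show ?thesis using that by simp
  qed
  have "a \<otimes> inv b = c \<otimes> inv d"
    using cancel[of a b g] cancel[of c d h] car g eq by simp
  then consider "a = c" "b = d" | "d = inv a" "c = inv b" using edge_quotient[OF e] by auto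
  then show ?thesis
  proof cases
    case 1
    then have "g = h" using eq g car by simp
    then show ?thesis using 1 by simp
  next
    case 2
    have "b \<otimes> (a \<otimes> g) = h" using eq(1) car g by (simp add: 2 m_assoc[symmetric])
    then have "h = a \<otimes> b \<otimes> g" unfolding edge_comm[OF e(1)] using car g by (simp add: m_assoc)
    then show ?thesis using 2 e(1) by (simp add: blue_step_pair insert_commute)
  qed
qed

lemma proj_eq_iff:
  assumes x: "x \<in> V" and y: "y \<in> V"
  shows "proj x = proj y \<longleftrightarrow> y = x \<or> y = B x"
proof
  assume eq: "proj x = proj y"
  obtain g a b where x': "x = (g, {a, b})" "g \<in> carrier G" "{a, b} \<in> cx_edges S"
    using V_cases[OF x] .
  obtain h c d where y': "y = (h, {c, d})" "h \<in> carrier G" "{c, d} \<in> cx_edges S"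
    using V_cases[OF y] .
  from eq have "a \<otimes> g = c \<otimes> h \<and> b \<otimes> g = d \<otimes> h \<or> a \<otimes> g = d \<otimes> h \<and> b \<otimes> g = c \<otimes> h"
    unfolding x' y' proj_pair doubleton_eq_iff .
  then show "y = x \<or> y = B x"
  proof (elim disjE conjE)
    assume "a \<otimes> g = c \<otimes> h" "b \<otimes> g = d \<otimes> h"
    from translated_edges_eq[OF x'(3) y'(3) x'(2) y'(2) this] show ?thesis
      unfolding x' y' .
  next
    assume eqs: "a \<otimes> g = d \<otimes> h" "b \<otimes> g = c \<otimes> h"
    \<comment> \<open>The crossed matching of endpoints is the parallel one after renaming the
      second edge.\<close>
    have dc: "{d, c} = {c, d}" by auto
    from translated_edges_eq[OF x'(3) _ x'(2) y'(2) eqs, unfolded dc, OF y'(3)] show ?thesis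
      unfolding x' y' .
  qed
qed (use proj_blue[OF x] in auto)

section \<open>Red neighbourhoods and injectivity of the projection\<close>

lemma red_sym: "red_rel S x y \<Longrightarrow> red_rel S y x"
  by (auto simp: red_rel_def walk_rel_def)

lemma N_fst: "y \<in> N x \<Longrightarrow> fst y = fst x"
  by (simp add: N_def red_rel_def)

text \<open>Distinct edges of one triangle have the form {a, b} and {a, c} with b \<noteq> c, so the
  translations ab and ac differ. Hence no blue edge joins \<open>N x\<close> to
  \<open>N (B x)\<close>.\<close>

lemma fst_blue_red_ne:
  assumes x: "x \<in> V" and y: "y \<in> N x"
  shows "fst (B y) \<noteq> fst (B x)"
proof -
  obtain g e e' where xy: "x = (g, e)" "y = (g, e')" "g \<in> carrier G" "e \<in> cx_edges S"
    "e' \<in> cx_edges S" "walk_rel S e e'"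
    using x y by (cases x; cases y) (auto simp: N_def red_rel_def)
  then obtain t where t: "t \<in> S" "e \<subseteq> t" "e' \<subseteq> t" "e \<noteq> e'" by (auto simp: walk_rel_def)
  have ce: "card e = 2" "card e' = 2" using xy by (auto simp: cx_edges_def)
  have ft: "finite t" using triangle(1)[OF t(1)] by (simp add: card_ge_0_finite)
  have "card (e \<union> e') \<le> 3" using card_mono[OF ft, of "e \<union> e'"] t triangle(1) by auto
  then have "e \<inter> e' \<noteq> {}"
    using ce card_Un_disjoint[of e e'] finite_subset[OF _ ft] t by fastforce
  then obtain a where a: "a \<in> e" "a \<in> e'" by auto
  obtain b where b: "e = {a, b}" using ce(1) a(1) unfolding card_2_iff by blast
  obtain c where c: "e' = {a, c}" using ce(2) a(2) unfolding card_2_iff by blast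
  have car: "a \<in> carrier G" "b \<in> carrier G" "c \<in> carrier G"
    using edge_carrier[OF xy(4)] edge_carrier[OF xy(5)] b c by auto
  have "a \<otimes> b \<noteq> a \<otimes> c" using car t(4) b c by auto
  then show ?thesis using xy car unfolding b c by (simp add: blue_step_pair)
qed

lemma red_ne: "x \<in> V \<Longrightarrow> y \<in> N x \<Longrightarrow> y \<noteq> x"
  by (auto simp: N_def red_rel_def walk_rel_def)

lemma proj_red_ne:
  assumes "x \<in> V" "y \<in> N x"
  shows "proj y \<noteq> proj x"
  using assms red_ne[OF assms] N_fst[OF assms(2)] fst_blue_ne[OF assms(1)]
    proj_eq_iff[OF assms(1), of y] by (auto simp: N_def)

lemma N_disjoint: "x \<in> V \<Longrightarrow> N x \<inter> N (B x) = {}"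
  using N_fst[of _ x] N_fst[of _ "B x"] fst_blue_ne[of x] by fastforce

text \<open>Colliding points form a blue pair. Inside one red neighbourhood the group component is
  constant while the blue step changes it; between the two neighbourhoods
  \<open>fst_blue_red_ne\<close> applies.\<close>

lemma inj_on_proj_N:
  assumes x: "x \<in> V"
  shows "inj_on proj (N x \<union> N (B x))"
proof (rule inj_onI, rule ccontr)
  fix y z assume y: "y \<in> N x \<union> N (B x)" and z: "z \<in> N x \<union> N (B x)"
    and eq: "proj y = proj z" and ne: "y \<noteq> z"
  have yV: "y \<in> V" and zV: "z \<in> V" using y z by (auto simp: N_def)
  have zy: "z = B y" using proj_eq_iff[OF yV zV] eq ne by auto
  then have yz: "y = B z" using blue_blue[OF yV] by simp
  have 1: "fst z \<noteq> fst y" using fst_blue_ne[OF yV] zy by simp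
  show False
    using y z
  proof (elim UnE)
    assume "y \<in> N x" "z \<in> N (B x)"
    then show False using fst_blue_red_ne[OF x \<open>y \<in> N x\<close>] zy N_fst[OF \<open>z \<in> N (B x)\<close>] by simp
  next
    assume "y \<in> N (B x)" "z \<in> N x"
    then show False using fst_blue_red_ne[OF x \<open>z \<in> N x\<close>] yz N_fst[OF \<open>y \<in> N (B x)\<close>] by simp
  qed (use 1 N_fst in metis)+
qed

section \<open>Edges of the translated complex and their neighbours\<close>

lemma card_translate:
  assumes "g \<in> carrier G" "e \<subseteq> carrier G"
  shows "card (rtrans G e g) = card e"
  unfolding rtrans_def using assms by (intro card_image inj_onI) (metis right_cancel subsetD)

lemma proj_edge:
  assumes "x \<in> V"
  shows "proj x \<in> cx_edges C"
proof -
  obtain g e where x: "x = (g, e)" "g \<in> carrier G" "e \<in> cx_edges S" using assms by auto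
  then obtain t where "t \<in> S" "e \<subseteq> t" "card e = 2" by (auto simp: cx_edges_def)
  then show ?thesis using x card_translate[OF x(2) edge_carrier[OF x(3)]]
    by (auto simp: proj_def cx_edges_def Sc_def rtrans_def)
qed

text \<open>All edges of one translated triangle lift with the same group component
  \<open>g\<close>, which is what turns adjacency in the walk graph into red adjacency.\<close>

lemma edge_in_translate:
  assumes "t \<in> S" "g \<in> carrier G" "e \<subseteq> rtrans G t g" "card e = 2"
  obtains e' where "e' \<subseteq> t" "e' \<in> cx_edges S" "e = proj (g, e')"
proof -
  obtain e' where e': "e' \<subseteq> t" "e = (\<lambda>s. s \<otimes> g) ` e'"
    using assms(3) unfolding rtrans_def subset_image_iff by blast
  then have "card e' = 2"
    using card_translate[OF assms(2), of e'] triangle(2)[OF assms(1)] assms(4)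
    by (simp add: rtrans_def)
  then show thesis using that[of e'] e' assms(1) by (auto simp: cx_edges_def proj_def rtrans_def)
qed

lemma edges_Sc: "cx_edges C = proj ` V"
proof
  show "cx_edges C \<subseteq> proj ` V"
  proof
    fix e assume "e \<in> cx_edges C"
    then obtain t g where t: "t \<in> S" "g \<in> carrier G" "e \<subseteq> rtrans G t g" "card e = 2"
      by (auto simp: cx_edges_def Sc_def)
    then show "e \<in> proj ` V" using edge_in_translate[OF t] by blast
  qed
qed (use proj_edge in blast)

lemma walk_neighbours_Sc:
  assumes x: "x \<in> V"
  shows "{e \<in> cx_edges C. walk_rel C (proj x) e} = proj ` (N x \<union> N (B x))"
proof
  show "{e \<in> cx_edges C. walk_rel C (proj x) e} \<subseteq> proj ` (N x \<union> N (B x))"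
  proof
    fix e assume "e \<in> {e \<in> cx_edges C. walk_rel C (proj x) e}"
    then obtain t g where t: "t \<in> S" "g \<in> carrier G" "e \<subseteq> rtrans G t g" "proj x \<subseteq> rtrans G t g"
      and e: "card e = 2" "proj x \<noteq> e"
      by (auto simp: cx_edges_def walk_rel_def Sc_def)
    have "card (proj x) = 2" using proj_edge[OF x] by (simp add: cx_edges_def)
    then obtain u where u: "u \<subseteq> t" "u \<in> cx_edges S" "proj x = proj (g, u)"
      using edge_in_translate t by blast
    obtain v where v: "v \<subseteq> t" "v \<in> cx_edges S" "e = proj (g, v)"
      using edge_in_translate[OF t(1,2,3) e(1)] .
    \<comment> \<open>The common triangle fixes \<open>g\<close>, but the given lift
      \<open>x\<close> may be the other point of the fibre; this is why \<open>N (B x)\<close>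
      appears.\<close>
    have "(g, u) = x \<or> (g, u) = B x" using proj_eq_iff[OF x] u t by auto
    moreover have "(g, v) \<in> N (g, u)"
      using u v t e by (auto simp: N_def red_rel_def walk_rel_def)
    ultimately show "e \<in> proj ` (N x \<union> N (B x))" using v(3) by auto
  qed
  have "walk_rel C (proj w) (proj y)" if w: "w \<in> V" and y: "y \<in> N w" for w y
  proof -
    obtain t where t: "t \<in> S" "snd w \<subseteq> t" "snd y \<subseteq> t"
      using y by (auto simp: N_def red_rel_def walk_rel_def)
    have "proj w \<subseteq> rtrans G t (fst w)" "proj y \<subseteq> rtrans G t (fst w)"
      using t N_fst[OF y] by (auto simp: proj_def rtrans_def)
    moreover have "rtrans G t (fst w) \<in> C" 
      unfolding Sc_def using t(1) w by (intro CollectI exI[of _ t] exI[of _ "fst w"]) auto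
    ultimately show ?thesis using proj_red_ne[OF w y] unfolding walk_rel_def by metis
  qed
  then show "proj ` (N x \<union> N (B x)) \<subseteq> {e \<in> cx_edges C. walk_rel C (proj x) e}"
    using x blue_in[OF x] proj_blue[OF x] proj_edge by (auto simp: N_def) metis+
qed

lemma finite_V: "finite V"
proof -
  have "cx_edges S \<subseteq> Pow (carrier G)" using edge_carrier by blast
  then show ?thesis using fin finite_subset by blast
qed

lemma V_nonempty: "V \<noteq> {}"
proof -
  obtain t where t: "t \<in> S" using cx by (auto simp: is_2complex_on_def)
  then obtain e where "e \<subseteq> t" "card e = 2"
    using obtain_subset_with_card_n[of 2 t] triangle(1)[OF t] by auto
  then have "e \<in> cx_edges S" using t by (auto simp: cx_edges_def)
  then show ?thesis by auto
qed

lemma finite_N: "finite (N x)"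
  using finite_V by (simp add: N_def)

lemma N_regular: "\<exists>d>0. \<forall>x\<in>V. card (N x) = 2 * d"
proof -
  have "\<exists>d. \<forall>e\<in>cx_edges S. card {t \<in> S. e \<subseteq> t} = d"
    using cts unfolding CTS_def by (elim conjE)
  then obtain d where d: "\<And>e. e \<in> cx_edges S \<Longrightarrow> card {t \<in> S. e \<subseteq> t} = d"
    by (elim exE) simp
  have N: "card (N x) = 2 * d" if "x \<in> V" for x
  proof -
    obtain g e where x: "x = (g, e)" "g \<in> carrier G" "e \<in> cx_edges S" using \<open>x \<in> V\<close> by auto
    have Nx: "N x = Pair g ` {e' \<in> cx_edges S. walk_rel S e e'}"
      using x by (auto simp: N_def red_rel_def)
    have "card (N x) = card {e' \<in> cx_edges S. walk_rel S e e'}"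
      unfolding Nx by (intro card_image inj_onI) simp
    also have "\<dots> = 2 * card {t \<in> S. e \<subseteq> t}"
      using x(3) finite_S triangle by (intro card_walk_neighbours) (auto simp: cx_edges_def)
    finally show ?thesis using d[OF x(3)] by simp
  qed
  obtain e where e: "e \<in> cx_edges S" using V_nonempty by auto
  then have "{t \<in> S. e \<subseteq> t} \<noteq> {}" by (auto simp: cx_edges_def)
  then have "card {t \<in> S. e \<subseteq> t} > 0" using finite_S by (simp add: card_gt_0_iff)
  then have "d > 0" unfolding d[OF e] .
  with N show ?thesis by (intro exI[of _ d]) simp
qed

section \<open>Comparison of the walk and zig-zag spectra\<close>

abbreviation "E \<equiv> cx_edges C"
abbreviation "P \<equiv> walk_op V (red_rel S)"
abbreviation "W \<equiv> walk_op E (walk_rel C)"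
abbreviation "Z f \<equiv> P (walk_op V (blue_rel G) (P f))"

lemma finite_E: "finite E"
  unfolding edges_Sc using finite_V by simp

lemma card_proj_N:
  assumes "x \<in> V" "\<And>x. x \<in> V \<Longrightarrow> card (N x) = k"
  shows "card {e \<in> E. walk_rel C (proj x) e} = 2 * k"
  unfolding walk_neighbours_Sc[OF assms(1)] card_image[OF inj_on_proj_N[OF assms(1)]]
  using card_Un_disjoint[OF finite_N finite_N N_disjoint[OF assms(1)]] assms blue_in[OF assms(1)]
  by simp

text \<open>The neighbours of \<open>proj x\<close> split into two equally large images of red
  neighbourhoods, so their average is the mean of two red averages.\<close>

lemma walk_op_proj:
  assumes x: "x \<in> V" and k: "\<And>x. x \<in> V \<Longrightarrow> card (N x) = k"
  shows "W f (proj x) = (P (f \<circ> proj) x + P (f \<circ> proj) (B x)) / 2"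
proof -
  have "(\<Sum>e | e \<in> E \<and> walk_rel C (proj x) e. f e) = (\<Sum>y\<in>N x \<union> N (B x). f (proj y))"
    unfolding walk_neighbours_Sc[OF x] sum.reindex[OF inj_on_proj_N[OF x]] by simp
  also have "\<dots> = (\<Sum>y\<in>N x. f (proj y)) + (\<Sum>y\<in>N (B x). f (proj y))"
    by (rule sum.union_disjoint[OF finite_N finite_N N_disjoint[OF x]])
  finally show ?thesis
    using k[OF x] k[OF blue_in[OF x]] card_proj_N[OF x k]
    unfolding walk_op_def N_def by (simp add: add_divide_distrib)
qed

text \<open>Every fibre is \<open>{x, B x}\<close> with two distinct points. This carries mean zero
  from \<open>E\<close> up to \<open>V\<close>.\<close>

lemma sum_proj:
  fixes f :: "'g set \<Rightarrow> real"
  shows "(\<Sum>x\<in>V. f (proj x)) = 2 * (\<Sum>e\<in>E. f e)"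
proof -
  have "(\<Sum>x\<in>V. f (proj x)) = (\<Sum>e\<in>proj ` V. \<Sum>x | x \<in> V \<and> proj x = e. f (proj x))"
    by (rule sum.image_gen[OF finite_V])
  also have "\<dots> = (\<Sum>e\<in>proj ` V. 2 * f e)"
  proof (rule sum.cong[OF refl])
    fix e assume "e \<in> proj ` V"
    then obtain x where x: "x \<in> V" "e = proj x" by (elim imageE)
    have fibre: "y \<in> V \<and> proj y = e \<longleftrightarrow> y = x \<or> y = B x" for y
      using proj_eq_iff[OF x(1), of y] x blue_in[OF x(1)] by metis
    have "{y \<in> V. proj y = e} = {x, B x}"
      by (rule Set.set_eqI) (simp only: mem_Collect_eq fibre insert_iff empty_iff simp_thms)
    moreover have "x \<noteq> B x" using fst_blue_ne[OF x(1)] by metis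
    ultimately show "(\<Sum>y | y \<in> V \<and> proj y = e. f (proj y)) = 2 * f e"
      using x proj_blue[OF x(1)] by simp
  qed
  finally show ?thesis by (simp add: edges_Sc sum_distrib_left)
qed

lemma sum_blue: "(\<Sum>x\<in>V. f (B x)) = (\<Sum>x\<in>V. f x)"
  by (rule sum.reindex_bij_witness[of _ B B]) (simp_all add: blue_in blue_blue del: mem_Sigma_iff)

text \<open>Since \<open>B\<close> is an involution on \<open>V\<close>, both clauses of
  \<open>blue_rel\<close> describe the same point. The blue graph is a perfect matching, and its
  walk operator is composition with \<open>B\<close>.\<close>

lemma blue_neighbours:
  assumes x: "x \<in> V"
  shows "{y \<in> V. blue_rel G x y} = {B x}"
proof -
  have "y = B x" if "y \<in> V" "blue_rel G x y" for y
    using blue_blue[OF that(1)] that(2) unfolding blue_rel_def by metis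
  moreover have "blue_rel G x (B x)" by (simp add: blue_rel_def)
  ultimately show ?thesis using blue_in[OF x] by blast
qed

lemma blue_sym: "blue_rel G x y \<Longrightarrow> blue_rel G y x"
  by (auto simp: blue_rel_def)

lemma blue_op: "x \<in> V \<Longrightarrow> walk_op V (blue_rel G) f x = f (B x)"
  unfolding walk_op_def by (simp add: blue_neighbours del: mem_Sigma_iff)

lemma walk_sym: "walk_rel C e e' \<Longrightarrow> walk_rel C e' e"
  by (auto simp: walk_rel_def)

text \<open>The palindromic product of two symmetric matrices is symmetric, and its factors are
  contractions fixing the constants, so the general Rayleigh bound applies.\<close>

lemma zigzag_rayleigh:
  assumes f: "(\<Sum>x\<in>V. f x) = 0"
  shows "(\<Sum>x\<in>V. f x * Z f x) \<le> lambda_nt (zigzag_op G S) * (\<Sum>x\<in>V. (f x)\<^sup>2)"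
proof -
  obtain d where d: "d > 0" "\<And>x. x \<in> V \<Longrightarrow> card {y \<in> V. red_rel S x y} = 2 * d"
    using N_regular unfolding N_def by (elim exE conjE) simp
  have pos: "2 * d > 0" using d(1) by simp
  have b: "card {y \<in> V. blue_rel G x y} = 1" if "x \<in> V" for x
    using blue_neighbours[OF that] by simp
  define R where "R = norm_adj V (red_rel S)"
  define Q where "Q = norm_adj V (blue_rel G)"
  have Rc: "R \<in> carrier_mat (card V) (card V)" and Qc: "Q \<in> carrier_mat (card V) (card V)"
    unfolding R_def Q_def by (intro norm_adj_carrier finite_V)+
  have Rt: "transpose_mat R = R" unfolding R_def
    by (rule norm_adj_symmetric[OF finite_V red_sym d(2)])
  have Qt: "transpose_mat Q = Q" unfolding Q_def
    by (rule norm_adj_symmetric[OF finite_V blue_sym b])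
  have z: "zigzag_op G S = R * Q * R" by (simp add: zigzag_op_def Let_def R_def Q_def)
  have "transpose_mat (R * Q * R) = transpose_mat R * (transpose_mat Q * transpose_mat R)"
    using Rc Qc transpose_mult[of "R * Q" "card V" "card V" R "card V"]
      transpose_mult[of R "card V" "card V" Q "card V"] by simp
  then have sym: "transpose_mat (zigzag_op G S) = zigzag_op G S"
    unfolding z Rt Qt using Rc Qc
    by (simp add: assoc_mult_mat[of _ "card V" "card V" _ "card V" _ "card V"])
  have op: "zigzag_op G S *\<^sub>v vec_of V g = vec_of V (Z g)" for g
  proof -
    have "zigzag_op G S *\<^sub>v vec_of V g = R *\<^sub>v (Q *\<^sub>v (R *\<^sub>v vec_of V g))"
      unfolding z using Rc Qc by (simp add: assoc_mult_mat_vec[of _ "card V" "card V" _ "card V"])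
    then show ?thesis unfolding R_def Q_def by (simp add: norm_adj_mult_vec_of[OF finite_V])
  qed
  have P1: "P (\<lambda>_. 1) x = 1" if "x \<in> V" for x
    using d(2)[OF that] d(1) by (intro walk_op_one) simp
  have Z1: "Z (\<lambda>_. 1) x = 1" if x: "x \<in> V" for x
  proof -
    have "Z (\<lambda>_. 1) x = P (\<lambda>_. 1) x"
      by (rule walk_op_cong) (simp add: blue_op P1 blue_in del: mem_Sigma_iff)
    then show ?thesis using P1[OF x] by simp
  qed
  have Pc: "(\<Sum>x\<in>V. (P g x)\<^sup>2) \<le> (\<Sum>x\<in>V. (g x)\<^sup>2)" for g
    by (rule walk_op_contraction[OF finite_V red_sym d(2) pos])
  have Bc: "(\<Sum>x\<in>V. (walk_op V (blue_rel G) g x)\<^sup>2) \<le> (\<Sum>x\<in>V. (g x)\<^sup>2)" for g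
    by (rule walk_op_contraction[OF finite_V blue_sym b]) simp_all
  have le: "(\<Sum>x\<in>V. g x * Z g x) \<le> (\<Sum>x\<in>V. (g x)\<^sup>2)" for g
    by (rule sum_mult_le_sum_squares) (rule order_trans[OF Pc order_trans[OF Bc Pc]])
  obtain x where x: "x \<in> V" using V_nonempty by (metis ex_in_conv)
  \<comment> \<open>A second eigenvalue exists because a vertex and its blue partner are
    distinct.\<close>
  have "card {x, B x} \<le> card V"
    using finite_V x blue_in[OF x] by (intro card_mono) (simp_all del: mem_Sigma_iff)
  moreover have "B x \<noteq> x" using fst_blue_ne[OF x] by metis
  ultimately have card: "card V \<ge> 2" by simp
  have c: "zigzag_op G S \<in> carrier_mat (card V) (card V)" unfolding z using Rc Qc by simp
  show ?thesis by (rule lambda_nt_rayleigh[OF finite_V card c sym op Z1 le f])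
qed

lemma walk_eigenfunction:
  "\<exists>f. (\<exists>e\<in>E. f e \<noteq> 0) \<and> (\<Sum>e\<in>E. f e) = 0
    \<and> (\<forall>e\<in>E. W f e = lambda_nt (norm_adj E (walk_rel C)) * f e)"
proof -
  obtain d where d: "d > 0" "\<And>x. x \<in> V \<Longrightarrow> card (N x) = 2 * d"
    using N_regular by (elim exE conjE) simp
  \<comment> \<open>Two lifts of \<open>e\<close>, each with \<open>2 * d\<close> red
    neighbours.\<close>
  have reg: "card {e' \<in> E. walk_rel C e e'} = 2 * (2 * d)" if "e \<in> E" for e
  proof -
    have "e \<in> proj ` V" using that unfolding edges_Sc .
    then obtain x where "x \<in> V" "e = proj x" by (elim imageE)
    then show ?thesis using card_proj_N[OF _ d(2)] by metis
  qed
  obtain x where x: "x \<in> V" using V_nonempty by (metis ex_in_conv)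
  obtain y where y: "y \<in> N x" using d(1) d(2)[OF x] by (metis card.empty ex_in_conv mult_is_0 not_gr_zero zero_neq_numeral)
  have "card {proj x, proj y} \<le> card E"
    using finite_E proj_edge x y by (intro card_mono) (auto simp: N_def simp del: mem_Sigma_iff)
  then have card: "card E \<ge> 2" using proj_red_ne[OF x y] by simp
  have pos: "2 * (2 * d) > 0" using d(1) by simp
  have W1: "W (\<lambda>_. 1) e = 1" if "e \<in> E" for e
    by (rule walk_op_one) (simp only: reg[OF that] pos)
  have le: "(\<Sum>e\<in>E. f e * W f e) \<le> (\<Sum>e\<in>E. (f e)\<^sup>2)" for f
    by (rule sum_mult_le_sum_squares, rule walk_op_contraction[OF finite_E walk_sym reg pos])
  have sym: "transpose_mat (norm_adj E (walk_rel C)) = norm_adj E (walk_rel C)"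
    by (rule norm_adj_symmetric[OF finite_E walk_sym reg])
  show ?thesis
    by (rule lambda_nt_eigenfunction[OF finite_E card norm_adj_carrier[OF finite_E] sym
        norm_adj_mult_vec_of[OF finite_E] W1 le])
qed

lemma lambda_walk_le:
  "lambda_nt (norm_adj E (walk_rel C)) \<le> sqrt (1/2 + 1/2 * lambda_nt (zigzag_op G S))"
proof -
  let ?l = "lambda_nt (norm_adj E (walk_rel C))"
  let ?z = "lambda_nt (zigzag_op G S)"
  obtain d where d: "d > 0" "\<And>x. x \<in> V \<Longrightarrow> card (N x) = 2 * d"
    using N_regular by (elim exE conjE) simp
  have pos: "2 * d > 0" using d(1) by simp
  obtain f e where e: "e \<in> E" "f e \<noteq> 0" and f0: "(\<Sum>e\<in>E. f e) = 0"
    and ev: "\<And>e. e \<in> E \<Longrightarrow> W f e = ?l * f e"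
    using walk_eigenfunction by (elim exE conjE bexE) simp
  define F where "F = f \<circ> proj"
  obtain x0 where x0: "x0 \<in> V" "e = proj x0" using e(1) unfolding edges_Sc by (elim imageE)
  have F0: "(\<Sum>x\<in>V. F x) = 0" using sum_proj[of f] f0 by (simp add: F_def)
  \<comment> \<open>A nonzero value of \<open>f\<close> at \<open>e\<close> lifts to
    \<open>x0\<close>; strict positivity permits the final cancellation.\<close>
  have FF: "(\<Sum>x\<in>V. (F x)\<^sup>2) > 0"
    using finite_V x0(1) by (rule sum_pos2) (use e(2) x0(2) in \<open>simp_all add: F_def\<close>)
  have Fev: "?l * F x = (P F x + P F (B x)) / 2" if "x \<in> V" for x
    using ev[OF proj_edge[OF that]] walk_op_proj[OF that d(2)] by (simp add: F_def)
  have "(\<Sum>x\<in>V. P F x * P F (B x)) = (\<Sum>x\<in>V. P F x * walk_op V (blue_rel G) (P F) x)"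
    by (intro sum.cong refl) (simp add: blue_op del: mem_Sigma_iff)
  also have "\<dots> = (\<Sum>x\<in>V. F x * Z F x)"
    by (rule walk_op_selfadjoint[OF finite_V red_sym d(2)[unfolded N_def], symmetric])
  also have "\<dots> \<le> ?z * (\<Sum>x\<in>V. (F x)\<^sup>2)"
    by (rule zigzag_rayleigh[OF F0])
  finally have 1: "(\<Sum>x\<in>V. P F x * P F (B x)) \<le> ?z * (\<Sum>x\<in>V. (F x)\<^sup>2)" .
  have 2: "(\<Sum>x\<in>V. (P F x)\<^sup>2) \<le> (\<Sum>x\<in>V. (F x)\<^sup>2)"
    by (rule walk_op_contraction[OF finite_V red_sym d(2)[unfolded N_def] pos])
  have "?l\<^sup>2 * (\<Sum>x\<in>V. (F x)\<^sup>2) = (\<Sum>x\<in>V. (?l * F x)\<^sup>2)"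
    by (simp add: power_mult_distrib sum_distrib_left)
  also have "\<dots> = (\<Sum>x\<in>V. (P F x)\<^sup>2 / 4 + (P F (B x))\<^sup>2 / 4 + P F x * P F (B x) / 2)"
  proof (rule sum.cong[OF refl])
    fix x assume "x \<in> V"
    show "(?l * F x)\<^sup>2 = (P F x)\<^sup>2 / 4 + (P F (B x))\<^sup>2 / 4 + P F x * P F (B x) / 2"
      unfolding Fev[OF \<open>x \<in> V\<close>] by (simp add: power2_eq_square field_simps)
  qed
  also have "\<dots> = (\<Sum>x\<in>V. (P F x)\<^sup>2) / 4 + (\<Sum>x\<in>V. (P F (B x))\<^sup>2) / 4
      + (\<Sum>x\<in>V. P F x * P F (B x)) / 2"
    by (simp add: sum.distrib sum_divide_distrib)
  \<comment> \<open>\<open>B\<close> permutes \<open>V\<close>, so the two quarters add up to one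
    half of the norm of \<open>P F\<close>.\<close>
  also have "(\<Sum>x\<in>V. (P F (B x))\<^sup>2) = (\<Sum>x\<in>V. (P F x)\<^sup>2)"
    by (rule sum_blue[of "\<lambda>x. (P F x)\<^sup>2"])
  finally have "?l\<^sup>2 * (\<Sum>x\<in>V. (F x)\<^sup>2) \<le> (1/2 + 1/2 * ?z) * (\<Sum>x\<in>V. (F x)\<^sup>2)"
    using 1 2 by (simp add: distrib_right)
  then have "?l\<^sup>2 \<le> 1/2 + 1/2 * ?z" using FF by (simp only: mult_le_cancel_right_pos)
  \<comment> \<open>No sign of the eigenvalue is assumed: the radicand dominates its square, hence
    is nonnegative.\<close>
  then show ?thesis by (rule real_le_rsqrt)
qed

end

theorem mainTheorem2:
  fixes G :: "('g, 'b) monoid_scheme" and S :: "'g set set"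
  assumes "group G" and "finite (carrier G)"
    and "is_2complex_on G S"
    and "CTS G S"
  shows "lambda_nt (norm_adj (cx_edges (Sc S G)) (walk_rel (Sc S G)))
           \<le> sqrt (1/2 + 1/2 * lambda_nt (zigzag_op G S))"
proof -
  interpret group G by fact
  interpret cts G S by unfold_locales fact+
  show ?thesis by (rule lambda_walk_le)
qed

end
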